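(* For every integer $n\ge 0$, the cop number of the $n$-dimensional Fibonacci cube $\Gamma_n$ is $$c(\Gamma_n)=\left\lceil\frac{\lceil n/2\rceil+1}{2}\right\rceil .$$ Equivalently, for every integer $q\ge0$, $$c(\Gamma_{4q})=q+1,\quad c(\Gamma_{4q+1})=q+1,\quad c(\Gamma_{4q+2})=q+1,\quad c(\Gamma_{4q+3})=q+2 .$$
   Context: The $n$-dimensional Fibonacci cube $\Gamma_n$ is the graph whose vertices are all binary strings of length $n$ that do not contain two consecutive $1$'s, two strings being adjacent iff they differ in exactly one bit (an induced subgraph of the hypercube $Q_n$). In particular $\Gamma_0=K_1$. Cops and Robbers: on a connected graph, the cops first choose initial vertices (several cops may share a vertex), then the robber chooses an initial vertex. The sides then move alternately, cops first; on the cops' turn every cop, and on the robber's turn the robber, either stays or moves to an adjacent vertex. All positions are visible to all players. The cops win if at some time a cop occupies the robber's vertex; the robber wins if he evades capture forever. The cop number $c(G)$ is the minimum number of cops that guarantees capture on $G$. *)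

theory Defs
  imports Complex_Main "Graph_Theory.Graph_Theory"
begin

section \<open>Fibonacci cubes\<close>

definition hypercube :: "nat \<Rightarrow> bool list pair_pre_digraph" where
  "hypercube n = \<lparr> pverts = {w. length w = n},
     parcs = {(u, v). length u = n \<and> length v = n \<and> card {i. i < n \<and> u ! i \<noteq> v ! i} = 1} \<rparr>"

definition fib_strings :: "nat \<Rightarrow> bool list set" where
  "fib_strings n = {w. length w = n \<and> (\<forall>i. Suc i < n \<longrightarrow> \<not> (w ! i \<and> w ! Suc i))}"

text \<open>The subgraph of the hypercube induced by the strings without two consecutive ones. The
  library's \<^const>\<open>induce_subgraph\<close> returns a \<^typ>\<open>('a, 'b) pre_digraph\<close>; this is the
  corresponding pair digraph (see \<open>with_proj_fib_cube\<close>).\<close>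

definition fib_cube :: "nat \<Rightarrow> bool list pair_pre_digraph" where
  "fib_cube n = \<lparr> pverts = fib_strings n,
     parcs = parcs (hypercube n) \<inter> fib_strings n \<times> fib_strings n \<rparr>"

lemma with_proj_fib_cube: "with_proj (fib_cube n) = with_proj (hypercube n) \<restriction> fib_strings n"
  by (auto simp: fib_cube_def induce_subgraph_def with_proj_def)

lemma finite_fib_strings: "finite (fib_strings n)"
  by (rule finite_subset[OF _ finite_lists_length_eq[of "UNIV :: bool set" n]])
    (auto simp: fib_strings_def)

lemma parcs_fib_cube_sym:
  assumes "(u, v) \<in> parcs (fib_cube n)"
  shows "(v, u) \<in> parcs (fib_cube n)"
proof -
  have "{i. i < n \<and> u ! i \<noteq> v ! i} = {i. i < n \<and> v ! i \<noteq> u ! i}"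
    by blast
  with assms show ?thesis
    by (simp add: fib_cube_def hypercube_def)
qed

lemma pair_graph_fib_cube: "pair_graph (fib_cube n)"
proof
  show "fst e \<in> pverts (fib_cube n)" "snd e \<in> pverts (fib_cube n)"
    if "e \<in> parcs (fib_cube n)" for e
    using that by (auto simp: fib_cube_def)
  show "finite (pverts (fib_cube n))"
    by (simp add: fib_cube_def finite_fib_strings)
  show "finite (parcs (fib_cube n))"
    by (simp add: fib_cube_def finite_fib_strings)
  show "fst e \<noteq> snd e" if "e \<in> parcs (fib_cube n)" for e
    using that by (cases e) (auto simp: fib_cube_def hypercube_def)
  show "symmetric (with_proj (fib_cube n))"
    unfolding symmetric_def with_proj_simps by (rule symI) (rule parcs_fib_cube_sym)
qed

section \<open>Cops and Robbers\<close>

definition move :: "'a pair_pre_digraph \<Rightarrow> 'a \<Rightarrow> 'a \<Rightarrow> bool" where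
  "move G u v \<longleftrightarrow> u \<in> pverts G \<and> v \<in> pverts G \<and> (v = u \<or> (u, v) \<in> parcs G)"

text \<open>\<open>r t\<close> is the vertex of the robber after his initial choice (\<open>t = 0\<close>) or after his \<open>t\<close>-th
  move. Plays are infinite: after a capture both sides may go on arbitrarily.\<close>

definition robber_play :: "'a pair_pre_digraph \<Rightarrow> (nat \<Rightarrow> 'a) \<Rightarrow> bool" where
  "robber_play G r \<longleftrightarrow> (\<forall>t. move G (r t) (r (Suc t)))"

text \<open>A strategy maps the list of all vertices the robber has occupied so far, oldest first, to
  the positions of the cops \<open>0, 1, \<dots>\<close>; it may thus depend on the whole history. The value at \<open>[]\<close>
  is the initial placement, and \<open>cops_at \<sigma> r t\<close> is the placement after \<open>t\<close> moves of the cops. The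
  positions of a play appear in the order
  \<open>cops_at \<sigma> r 0, r 0, cops_at \<sigma> r 1, r 1, cops_at \<sigma> r 2, \<dots>\<close>\<close>

type_synonym 'a strategy = "'a list \<Rightarrow> nat \<Rightarrow> 'a"

definition cops_at :: "'a strategy \<Rightarrow> (nat \<Rightarrow> 'a) \<Rightarrow> nat \<Rightarrow> nat \<Rightarrow> 'a" where
  "cops_at \<sigma> r t = \<sigma> (map r [0..<t])"

definition legal_strategy :: "'a pair_pre_digraph \<Rightarrow> nat \<Rightarrow> 'a strategy \<Rightarrow> bool" where
  "legal_strategy G k \<sigma> \<longleftrightarrow> (\<forall>j<k. \<sigma> [] j \<in> pverts G) \<and>
     (\<forall>r t. robber_play G r \<longrightarrow> (\<forall>j<k. move G (cops_at \<sigma> r t j) (cops_at \<sigma> r (Suc t) j)))"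

text \<open>The first disjunct is a capture after the robber's turn, the second one after the cops'.\<close>

definition captures :: "nat \<Rightarrow> 'a strategy \<Rightarrow> (nat \<Rightarrow> 'a) \<Rightarrow> bool" where
  "captures k \<sigma> r \<longleftrightarrow> (\<exists>t. \<exists>j<k. cops_at \<sigma> r t j = r t \<or> cops_at \<sigma> r (Suc t) j = r t)"

definition cops_win :: "'a pair_pre_digraph \<Rightarrow> nat \<Rightarrow> bool" where
  "cops_win G k \<longleftrightarrow>
     (\<exists>\<sigma>. legal_strategy G k \<sigma> \<and> (\<forall>r. robber_play G r \<longrightarrow> captures k \<sigma> r))"

definition cop_number :: "'a pair_pre_digraph \<Rightarrow> nat" where
  "cop_number G = (LEAST k. cops_win G k)"

text \<open>On a finite graph the minimum is attained.\<close>

lemma cops_win_card: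
  assumes "finite (pverts G)"
  shows "cops_win G (card (pverts G))"
proof -
  obtain f where f: "bij_betw f {0..<card (pverts G)} (pverts G)"
    using ex_bij_betw_nat_finite[OF assms] by blast
  let ?s = "\<lambda>h :: 'a list. f"
  have f_in: "j < card (pverts G) \<Longrightarrow> f j \<in> pverts G" for j
    using f by (auto simp: bij_betw_def)
  then have legal: "legal_strategy G (card (pverts G)) ?s"
    by (auto simp: legal_strategy_def cops_at_def move_def)
  have "captures (card (pverts G)) ?s r" if "robber_play G r" for r
  proof -
    have "r 0 \<in> pverts G" using that by (auto simp: robber_play_def move_def)
    then obtain j where "j < card (pverts G)" "f j = r 0"
      using f by (metis atLeastLessThan_iff bij_betw_def imageE)
    then show ?thesis by (auto simp: captures_def cops_at_def)
  qed
  with legal show ?thesis unfolding cops_win_def by blast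
qed

end

theory Submission
  imports Defs
begin

text \<open>Put \<open>m = \<lceil>n/2\<rceil>\<close>.

  Lower bound: zeroing the bits at odd (0-based) positions retracts the cube onto a hypercube
  \<open>Q\<^sub>m\<close>. A robber who stays there need only flee the shadows of the cops, and a cop who
  differs from him in \<open>d > 0\<close> coordinates threatens at most \<open>d\<close> of his \<open>m\<close> neighbours if
  \<open>d \<le> 2\<close>, none if \<open>d > 2\<close>, and his own vertex only if \<open>d = 1\<close>. So \<open>k\<close> cops with
  \<open>2 k \<le> m\<close> leave him a safe move.

  Upper bound: reading the bits in pairs embeds the cube into the product of \<open>m\<close> paths
  \<open>{0, 1, 2}\<close>, and replacing blocks \<open>11\<close> by \<open>00\<close> from left to right retracts onto the cube, so
  the cops may play in the product. There every cop can prevent his distance to the robber from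
  growing. Let \<open>U\<close> be the set of the coordinates in which some cop differs from the robber. One
  cop keeps distance at least 1 and the others at least 2, so with \<open>2 k > m\<close> cops the
  distances sum to at least \<open>m\<close>. If the robber moves in a coordinate outside \<open>U\<close>, some coordinate of \<open>U\<close>
  is therefore covered with surplus, and one cop shifts a unit of his distance from there to the
  new coordinate, enlarging \<open>U\<close>. If the robber moves inside \<open>U\<close>, he either approaches a cop or
  runs away from all of them towards the end of a path, and if he passes, the first cop approaches.\<close>

section \<open>Positional strategies\<close>

text \<open>A state may carry more than the vertices \<open>pos\<close> shows, so the cops can play
  in a larger graph and display only its image. Folding over the robber's history recovers the
  state, and an uncaught robber would produce an infinite \<open>R\<close>-descent.\<close>

lemma cops_winI:
  fixes pos :: "'s \<Rightarrow> nat \<Rightarrow> 'a"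
  assumes wf: "wf R"
    and pos: "\<And>s j. j < k \<Longrightarrow> pos s j \<in> pverts G"
    and init: "\<And>x. x \<in> pverts G \<Longrightarrow> \<exists>s. (\<forall>j<k. move G (pos s0 j) (pos s j)) \<and>
      ((\<exists>j<k. pos s j = x) \<or> I s x)"
    and step: "\<And>s x y. I s x \<Longrightarrow> move G x y \<Longrightarrow> \<exists>s'. (\<forall>j<k. move G (pos s j) (pos s' j)) \<and>
      ((\<exists>j<k. pos s' j = y) \<or> I s' y \<and> ((s', y), (s, x)) \<in> R)"
  shows "cops_win G k"
proof -
  have stay: "\<forall>j<k. move G (pos s j) (pos s j)" for s
    using pos by (simp add: move_def)
  define ini_ok where "ini_ok x s \<longleftrightarrow> (\<forall>j<k. move G (pos s0 j) (pos s j)) \<and>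
    (x \<in> pverts G \<longrightarrow> (\<exists>j<k. pos s j = x) \<or> I s x)" for x s
  define ini where "ini x = (SOME s. ini_ok x s)" for x
  have "\<exists>s. ini_ok x s" for x
    using init[of x] stay[of s0] unfolding ini_ok_def by blast
  then have ini_ok: "ini_ok x (ini x)" for x
    unfolding ini_def by (rule someI_ex)
  have ini: "\<And>x j. j < k \<Longrightarrow> move G (pos s0 j) (pos (ini x) j)"
    "\<And>x. x \<in> pverts G \<Longrightarrow> (\<exists>j<k. pos (ini x) j = x) \<or> I (ini x) x"
    using ini_ok unfolding ini_ok_def by simp_all
  \<comment> \<open>Outside the invariant, as after a capture, standing still satisfies
    \<open>nxt_ok\<close>. So the choice always succeeds and every cop move is legal.\<close>
  define nxt_ok where "nxt_ok s x y s' \<longleftrightarrow> (\<forall>j<k. move G (pos s j) (pos s' j)) \<and>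
    (I s x \<and> move G x y \<longrightarrow> (\<exists>j<k. pos s' j = y) \<or> I s' y \<and> ((s', y), (s, x)) \<in> R)"
    for s x y s'
  define nxt where "nxt s x y = (SOME s'. nxt_ok s x y s')" for s x y
  have "\<exists>s'. nxt_ok s x y s'" for s x y
    using step[of s x y] stay[of s] unfolding nxt_ok_def by blast
  then have nxt_ok: "nxt_ok s x y (nxt s x y)" for s x y
    unfolding nxt_def by (rule someI_ex)
  have nxt: "\<And>s x y j. j < k \<Longrightarrow> move G (pos s j) (pos (nxt s x y) j)"
    "\<And>s x y. I s x \<Longrightarrow> move G x y \<Longrightarrow> (\<exists>j<k. pos (nxt s x y) j = y) \<or>
      I (nxt s x y) y \<and> ((nxt s x y, y), (s, x)) \<in> R"
    using nxt_ok unfolding nxt_ok_def by simp_all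
  define upd where "upd = (\<lambda>(s, x) y. (nxt s x y, y))"
  define \<sigma> where "\<sigma> h = (case h of [] \<Rightarrow> pos s0 | x # xs \<Rightarrow> pos (fst (foldl upd (ini x, x) xs)))"
    for h
  define st where "st r = rec_nat (ini (r 0)) (\<lambda>t s. nxt s (r t) (r (Suc t)))" for r
  have st_0: "st r 0 = ini (r 0)" and st_Suc: "st r (Suc t) = nxt (st r t) (r t) (r (Suc t))" for r t
    by (simp_all add: st_def)
  have fold: "foldl upd (ini (r 0), r 0) (map r [Suc 0..<Suc t]) = (st r t, r t)" for r t
    by (induction t) (simp_all add: st_0 st_Suc upd_def)
  have at_0: "cops_at \<sigma> r 0 = pos s0" for r
    by (simp add: cops_at_def \<sigma>_def)
  \<comment> \<open>Index shift: \<open>st r t\<close> already answers \<open>r t\<close>, so it is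
    the placement after \<open>Suc t\<close> cop moves.\<close>
  have at_Suc: "cops_at \<sigma> r (Suc t) = pos (st r t)" for r t
  proof -
    have "map r [0..<Suc t] = r 0 # map r [Suc 0..<Suc t]"
      by (simp add: upt_conv_Cons del: upt_Suc)
    then show ?thesis
      by (simp add: cops_at_def \<sigma>_def fold del: upt_Suc)
  qed
  have "move G (cops_at \<sigma> r t j) (cops_at \<sigma> r (Suc t) j)" if "j < k" for r t j
    using that by (cases t) (auto simp: at_0 at_Suc st_0 st_Suc ini(1) nxt(1))
  then have "legal_strategy G k \<sigma>"
    unfolding legal_strategy_def using pos by (auto simp: \<sigma>_def)
  moreover have "captures k \<sigma> r" if r: "robber_play G r" for r
  proof (rule ccontr)
    assume "\<not> captures k \<sigma> r"
    then have free: "\<not> (\<exists>j<k. pos (st r t) j = r t)" for t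
      unfolding captures_def using at_Suc by metis
    have mv: "move G (r t) (r (Suc t))" for t
      using r by (simp add: robber_play_def)
    have I: "I (st r t) (r t)" for t
    proof (induction t)
      case 0
      have "r 0 \<in> pverts G"
        using mv[of 0] by (simp add: move_def)
      from ini(2)[OF this] free[of 0] show ?case
        by (auto simp: st_0)
    next
      case (Suc t)
      from nxt(2)[OF Suc mv] free[of "Suc t"] show ?case
        by (auto simp: st_Suc)
    qed
    have "((st r (Suc t), r (Suc t)), (st r t, r t)) \<in> R" for t
      using nxt(2)[OF I mv, of t] free[of "Suc t"] by (auto simp: st_Suc)
    then show False
      using wf unfolding wf_iff_no_infinite_down_chain
      by (auto dest!: spec[of _ "\<lambda>t. (st r t, r t)"])
  qed
  ultimately show ?thesis
    unfolding cops_win_def by blast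
qed

section \<open>Pursuit in a product of paths\<close>

definition ldist :: "nat \<Rightarrow> (nat \<Rightarrow> int) \<Rightarrow> (nat \<Rightarrow> int) \<Rightarrow> nat" where
  "ldist m c e = (\<Sum>i<m. nat \<bar>c i - e i\<bar>)"

text \<open>Values are not confined to 0, 1, 2: decoding by \<open>bits\<close> treats every value
  other than 0 and 2 like 1.\<close>

definition unit_step :: "(nat \<Rightarrow> int) \<Rightarrow> (nat \<Rightarrow> int) \<Rightarrow> bool" where
  "unit_step c c' \<longleftrightarrow> (\<exists>i z. c' = c(i := z) \<and> \<bar>z - c i\<bar> \<le> 1)"

lemma unit_step_refl [simp]: "unit_step c c"
  unfolding unit_step_def by (metis abs_zero diff_self fun_upd_triv zero_le_one)

lemma unit_step_upd [simp]: "\<bar>z - c i\<bar> \<le> 1 \<Longrightarrow> unit_step c (c(i := z))"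
  unfolding unit_step_def by blast

lemma ldist_remove:
  "i < m \<Longrightarrow> ldist m c e = nat \<bar>c i - e i\<bar> + (\<Sum>i'\<in>{..<m} - {i}. nat \<bar>c i' - e i'\<bar>)"
  unfolding ldist_def by (simp add: sum.remove)

lemma ldist_upd_left:
  assumes "i < m"
  shows "ldist m (c(i := z)) e + nat \<bar>c i - e i\<bar> = ldist m c e + nat \<bar>z - e i\<bar>"
proof -
  have "(\<Sum>i'\<in>{..<m} - {i}. nat \<bar>(c(i := z)) i' - e i'\<bar>) = (\<Sum>i'\<in>{..<m} - {i}. nat \<bar>c i' - e i'\<bar>)"
    by (rule sum.cong) auto
  then show ?thesis
    using assms by (simp add: ldist_remove)
qed

lemma ldist_commute: "ldist m c e = ldist m e c"
  unfolding ldist_def by (simp add: abs_minus_commute)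

lemma ldist_upd_right:
  assumes "i < m"
  shows "ldist m c (e(i := z)) + nat \<bar>c i - e i\<bar> = ldist m c e + nat \<bar>c i - z\<bar>"
  using ldist_upd_left[OF assms, of e z c] by (simp add: ldist_commute abs_minus_commute)

lemma ldist_follow: "ldist m (c(i := c i + d)) (e(i := e i + d)) = ldist m c e"
  unfolding ldist_def by (rule sum.cong) auto

lemma ldist_eq_0: "ldist m c e = 0 \<longleftrightarrow> (\<forall>i<m. c i = e i)"
  unfolding ldist_def by auto

lemma ldist_approach:
  assumes "i < m" "c i \<noteq> e i"
  shows "Suc (ldist m (c(i := c i + sgn (e i - c i))) e) = ldist m c e"
  using ldist_upd_left[OF assms(1), of c "c i + sgn (e i - c i)" e] assms(2)
  by (auto simp: sgn_if split: if_splits)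

lemma ldist_decrease:
  assumes "ldist m c e > 0"
  shows "\<exists>c'. unit_step c c' \<and> Suc (ldist m c' e) = ldist m c e"
proof -
  from assms obtain i where "i < m" "c i \<noteq> e i"
    using ldist_eq_0[of m c e] by auto
  from ldist_approach[of i m c e, OF this] show ?thesis
    by (intro exI[of _ "c(i := c i + sgn (e i - c i))"]) (auto simp: sgn_if)
qed

text \<open>The bound on the distance that cop \<open>j\<close> does not undercut before the capture: cop 0 makes
  progress when the robber passes, the others stop at distance 2, from where they guard two
  coordinates.\<close>

definition reserve :: "nat \<Rightarrow> nat" where
  "reserve j = (if j = 0 then 1 else 2)"

definition kept :: "nat \<Rightarrow> nat \<Rightarrow> (nat \<Rightarrow> nat \<Rightarrow> int) \<Rightarrow> (nat \<Rightarrow> int) \<Rightarrow> bool" where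
  "kept m k s e \<longleftrightarrow> (\<forall>j<k. reserve j \<le> ldist m (s j) e)"

definition covered :: "nat \<Rightarrow> nat \<Rightarrow> (nat \<Rightarrow> nat \<Rightarrow> int) \<Rightarrow> (nat \<Rightarrow> int) \<Rightarrow> nat set" where
  "covered m k s e = {i. i < m \<and> (\<exists>j<k. s j i \<noteq> e i)}"

text \<open>How far the robber can still run in each coordinate, away from the cops if they are all on
  one side.\<close>

definition room :: "nat \<Rightarrow> nat \<Rightarrow> (nat \<Rightarrow> nat \<Rightarrow> int) \<Rightarrow> (nat \<Rightarrow> int) \<Rightarrow> nat" where
  "room m k s e = (\<Sum>i<m. nat (if \<exists>j<k. s j i < e i then 2 - e i else e i))"

text \<open>Compared lexicographically. A pass or an approach to a cop lowers the total distance; a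
  move in an uncovered coordinate keeps it and enlarges \<open>covered\<close>; a flight within
  \<open>covered\<close> keeps both and uses up \<open>room\<close>.\<close>

definition potential ::
    "nat \<Rightarrow> nat \<Rightarrow> (nat \<Rightarrow> nat \<Rightarrow> int) \<Rightarrow> (nat \<Rightarrow> int) \<Rightarrow> nat \<times> nat \<times> nat" where
  "potential m k s e = (\<Sum>j<k. ldist m (s j) e, m - card (covered m k s e), room m k s e)"

abbreviation potential_less :: "((nat \<times> nat \<times> nat) \<times> nat \<times> nat \<times> nat) set" where
  "potential_less \<equiv> less_than <*lex*> less_than <*lex*> less_than"

lemma sum_reserve:
  assumes "0 < k"
  shows "(\<Sum>j<k. reserve j) = 2 * k - 1"
proof -
  from assms obtain k' where k: "k = Suc k'"
    by (cases k) auto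
  have "(\<Sum>j<Suc k'. reserve j) = 2 * Suc k' - 1"
    by (induction k') (auto simp: reserve_def)
  then show ?thesis
    by (simp add: k)
qed

text \<open>Pigeonhole: the distances sum to at least \<open>2 * k - 1\<close>, hence to at least
  \<open>m\<close>, and none of it lies in \<open>i\<close>, so one of the other
  \<open>m - 1\<close> coordinates carries 2 units. The last disjunction lets cop \<open>j0\<close>
  give up a unit in \<open>i0\<close> without uncovering it.\<close>

lemma exists_surplus:
  assumes kept: "kept m k s e" and k: "m < 2 * k" and i: "i < m" "i \<notin> covered m k s e"
  obtains j0 i0 where "j0 < k" "i0 < m" "s j0 i0 \<noteq> e i0"
    "2 \<le> \<bar>s j0 i0 - e i0\<bar> \<or> (\<exists>j<k. j \<noteq> j0 \<and> s j i0 \<noteq> e i0)"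
proof -
  let ?f = "\<lambda>i. \<Sum>j<k. nat \<bar>s j i - e i\<bar>"
  have "\<exists>i0<m. 2 \<le> ?f i0"
  proof (rule ccontr)
    assume small: "\<not> ?thesis"
    have fi: "?f i = 0"
      using i by (auto simp: covered_def)
    have "m \<le> (\<Sum>j<k. reserve j)"
      using k by (simp add: sum_reserve)
    also have "\<dots> \<le> (\<Sum>j<k. ldist m (s j) e)"
      using kept by (intro sum_mono) (auto simp: kept_def)
    also have "\<dots> = (\<Sum>i<m. ?f i)"
      unfolding ldist_def by (rule sum.swap)
    also have "\<dots> = (\<Sum>i'\<in>{..<m} - {i}. ?f i')"
      using i fi by (subst sum.remove[of _ i]) auto
    also have "\<dots> \<le> (\<Sum>i'\<in>{..<m} - {i}. 1)"
      using small by (intro sum_mono) force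
    also have "\<dots> < m"
      using i by simp
    finally show False by simp
  qed
  then obtain i0 where i0: "i0 < m" "2 \<le> ?f i0" by blast
  then have "?f i0 \<noteq> 0" by linarith
  then obtain j0 where j0: "j0 < k" "s j0 i0 \<noteq> e i0"
    by (auto simp: sum_eq_0_iff)
  have "2 \<le> \<bar>s j0 i0 - e i0\<bar> \<or> (\<exists>j<k. j \<noteq> j0 \<and> s j i0 \<noteq> e i0)"
  proof (rule ccontr)
    assume neg: "\<not> ?thesis"
    have "?f i0 = nat \<bar>s j0 i0 - e i0\<bar> + (\<Sum>j\<in>{..<k} - {j0}. nat \<bar>s j i0 - e i0\<bar>)"
      using j0 by (simp add: sum.remove)
    also have "(\<Sum>j\<in>{..<k} - {j0}. nat \<bar>s j i0 - e i0\<bar>) = 0"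
      using neg by auto
    finally show False
      using i0 neg by linarith
  qed
  with j0 i0 that show thesis by blast
qed

lemma pursuit_step:
  assumes kept: "kept m k s e" and k: "m < 2 * k"
    and step: "unit_step e e'" and e: "\<And>i. 0 \<le> e i \<and> e i \<le> 2" and e': "\<And>i. 0 \<le> e' i \<and> e' i \<le> 2"
  shows "\<exists>s'. (\<forall>j<k. unit_step (s j) (s' j)) \<and>
    ((\<exists>j<k. ldist m (s' j) e' = 0) \<or>
     kept m k s' e' \<and> (potential m k s' e', potential m k s e) \<in> potential_less)"
proof (cases "\<exists>j<k. ldist m (s j) e' \<le> 1")
  case True
  then obtain j where j: "j < k" "ldist m (s j) e' \<le> 1" by blast
  have "\<exists>c. unit_step (s j) c \<and> ldist m c e' = 0"
  proof (cases "ldist m (s j) e' = 0")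
    case False
    with j ldist_decrease[of m "s j" e'] show ?thesis by fastforce
  qed (use unit_step_refl in blast)
  then obtain c where "unit_step (s j) c" "ldist m c e' = 0" by blast
  with j show ?thesis
    by (intro exI[of _ "s(j := c)"]) auto
next
  case False
  \<comment> \<open>No cop can capture at once, so each one meets his \<open>reserve\<close> even if
    he stands still.\<close>
  then have far: "2 \<le> ldist m (s j) e'" if "j < k" for j
    using that by force
  from step obtain i z where ez: "e' = e(i := z)" "\<bar>z - e i\<bar> \<le> 1"
    by (auto simp: unit_step_def)
  show ?thesis
  proof (cases "i < m \<and> z \<noteq> e i")
    \<comment> \<open>A pass, or a change outside the first \<open>m\<close> coordinates, which
      \<open>ldist\<close> ignores.\<close>
    case False
    have same: "ldist m c e' = ldist m c e" for c
      unfolding ldist_def using False ez by (intro sum.cong) auto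
    have k0: "0 < k" using k by linarith
    obtain c where c: "unit_step (s 0) c" "Suc (ldist m c e) = ldist m (s 0) e"
      using ldist_decrease[of m "s 0" e] far[OF k0] same by force
    let ?s = "s(0 := c)"
    have "kept m k ?s e'"
      using far[of 0] kept k0 c(2) unfolding kept_def same by (auto simp: reserve_def)
    moreover have "(\<Sum>j<k. ldist m (?s j) e') < (\<Sum>j<k. ldist m (s j) e)"
      unfolding same using k0 c(2) by (intro sum_strict_mono_ex1) auto
    ultimately show ?thesis
      using c(1) by (intro exI[of _ ?s]) (auto simp: potential_def)
  next
    case True
    then have i: "i < m" and z: "z \<noteq> e i" by auto
    define d where "d = z - e i"
    have d: "d = 1 \<or> d = -1" and e'_eq: "e' = e(i := e i + d)"
      using z ez by (auto simp: d_def)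
    \<comment> \<open>Copying the robber's step preserves the distance exactly.\<close>
    define follow where "follow j = (s j)(i := s j i + d)" for j
    have follow_step: "unit_step (s j) (follow j)" for j
      unfolding follow_def using d by auto
    have follow_dist: "ldist m (follow j) e' = ldist m (s j) e" for j
      unfolding follow_def e'_eq by (rule ldist_follow)
    define toward where "toward j \<longleftrightarrow> d * (s j i - e i) > 0" for j
    have toward_dist: "ldist m (s j) e' < ldist m (s j) e" if "toward j" for j
      using ldist_upd_right[OF i, of "s j" e "e i + d"] d that
      unfolding toward_def e'_eq by auto
    consider (towards) "\<exists>j<k. toward j"
      | (away) "\<forall>j<k. \<not> toward j" "i \<in> covered m k s e"
      | (new) "i \<notin> covered m k s e"
      by blast
    then show ?thesis
    proof cases
      case towards
      \<comment> \<open>Cops whom the robber approaches wait and gain; the others copy his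
        step.\<close>
      let ?s = "\<lambda>j. if toward j then s j else follow j"
      have "kept m k ?s e'"
        unfolding kept_def
      proof (intro allI impI)
        show "reserve j \<le> ldist m (?s j) e'" if "j < k" for j
          using kept far[OF that] that by (auto simp: kept_def follow_dist reserve_def)
      qed
      moreover have "(\<Sum>j<k. ldist m (?s j) e') < (\<Sum>j<k. ldist m (s j) e)"
        using towards toward_dist
        by (intro sum_strict_mono_ex1) (auto simp: follow_dist intro: less_imp_le)
      ultimately show ?thesis
        using follow_step by (intro exI[of _ ?s]) (auto simp: potential_def)
    next
      case away
      \<comment> \<open>When all cops copy, every difference survives, so \<open>covered\<close> and
        the sides on which the cops stand do not change.\<close>
      have diff: "follow j i' - e' i' = s j i' - e i'" for j i'
        by (simp add: follow_def e'_eq)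
      have ne: "follow j i' \<noteq> e' i' \<longleftrightarrow> s j i' \<noteq> e i'" and lt: "follow j i' < e' i' \<longleftrightarrow> s j i' < e i'"
        for j i' using diff[of j i'] by linarith+
      have cov: "covered m k follow e' = covered m k s e"
        by (simp only: covered_def ne)
      obtain j where j: "j < k" "s j i \<noteq> e i"
        using away(2) by (auto simp: covered_def)
      let ?behind = "\<lambda>i'. \<exists>j<k. s j i' < e i'"
      \<comment> \<open>If \<open>d = 1\<close>, some cop differs in \<open>i\<close> and none is
        ahead, so one is behind and \<open>2 - e i\<close> is counted. If \<open>d = -1\<close>,
        none is behind and \<open>e i\<close> is counted. Either quantity shrinks.\<close>
      have lt_i: "nat (if ?behind i then 2 - e' i else e' i) < nat (if ?behind i then 2 - e i else e i)"
      proof (cases "d = 1")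
        case True
        then have "s j i < e i"
          using away(1) j by (force simp: toward_def)
        then show ?thesis
          using j e[of i] e'[of i] True by (auto simp: e'_eq)
      next
        case False
        with d have "d = -1" by simp
        then have "\<not> ?behind i"
          using away(1) by (auto simp: toward_def)
        with \<open>d = -1\<close> show ?thesis
          using e[of i] e'[of i] by (auto simp: e'_eq)
      qed
      have "room m k follow e' = (\<Sum>i'<m. nat (if ?behind i' then 2 - e' i' else e' i'))"
        by (simp only: room_def lt)
      also have "\<dots> < room m k s e"
        unfolding room_def
      proof (rule sum_strict_mono_ex1)
        show "\<forall>i'\<in>{..<m}. nat (if ?behind i' then 2 - e' i' else e' i')
            \<le> nat (if ?behind i' then 2 - e i' else e i')"
        proof
          show "nat (if ?behind i' then 2 - e' i' else e' i') \<le> nat (if ?behind i' then 2 - e i' else e i')"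
            for i'
          proof (cases "i' = i")
            case True
            with lt_i show ?thesis by (simp only: less_imp_le)
          next
            case False
            then have "e' i' = e i'" by (simp add: e'_eq)
            then show ?thesis by (simp only: order_refl)
          qed
        qed
        show "\<exists>i'\<in>{..<m}. nat (if ?behind i' then 2 - e' i' else e' i')
            < nat (if ?behind i' then 2 - e i' else e i')"
          using i lt_i by blast
      qed simp
      finally have "room m k follow e' < room m k s e" .
      then show ?thesis
        using kept follow_step cov
        by (intro exI[of _ follow]) (auto simp: potential_def kept_def follow_dist)
    next
      case new
      obtain j0 i0 where j0: "j0 < k" and i0: "i0 < m" "s j0 i0 \<noteq> e i0"
        and surplus: "2 \<le> \<bar>s j0 i0 - e i0\<bar> \<or> (\<exists>j<k. j \<noteq> j0 \<and> s j i0 \<noteq> e i0)"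
        using exists_surplus[OF kept k i new] by metis
      have si: "s j i = e i" if "j < k" for j
        using new i that by (auto simp: covered_def)
      have ii: "i0 \<noteq> i" using si[OF j0] i0 by auto
      \<comment> \<open>Cop \<open>j0\<close> does not copy: he gains a unit of distance in
        \<open>i\<close> and spends one in \<open>i0\<close>, so all distances stay as
        before.\<close>
      let ?c = "(s j0)(i0 := s j0 i0 + sgn (e i0 - s j0 i0))"
      let ?s = "follow(j0 := ?c)"
      have "Suc (ldist m ?c e') = ldist m (s j0) e'"
        using ldist_approach[of i0 m "s j0" e'] i0 ii by (simp add: e'_eq)
      moreover have "ldist m (s j0) e' = Suc (ldist m (s j0) e)"
        using ldist_upd_right[OF i, of "s j0" e "e i + d"] d si[OF j0] unfolding e'_eq by auto
      ultimately have dist: "ldist m (?s j) e' = ldist m (s j) e" for j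
        by (simp add: follow_dist)
      \<comment> \<open>Now \<open>j0\<close> covers \<open>i\<close>, the surplus keeps
        \<open>i0\<close> covered, and elsewhere the same cop differs as before.\<close>
      have sub: "insert i (covered m k s e) \<subseteq> covered m k ?s e'"
      proof -
        have "\<exists>j<k. ?s j i' \<noteq> e' i'" if "i' \<in> insert i (covered m k s e)" for i'
        proof (cases "i' = i")
          case True
          then show ?thesis
            using j0 si[OF j0] ii d by (intro exI[of _ j0]) (auto simp: e'_eq)
        next
          case False
          with that obtain j where j: "j < k" "s j i' \<noteq> e i'"
            by (auto simp: covered_def)
          show ?thesis
          proof (cases "i' = i0")
            case True
            from surplus show ?thesis
            proof
              assume "2 \<le> \<bar>s j0 i0 - e i0\<bar>"
              then show ?thesis
                using j0 ii True by (intro exI[of _ j0]) (auto simp: e'_eq sgn_if)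
            next
              assume "\<exists>j<k. j \<noteq> j0 \<and> s j i0 \<noteq> e i0"
              then show ?thesis
                using ii True by (auto simp: e'_eq follow_def)
            qed
          next
            case False
            then show ?thesis
              using j \<open>i' \<noteq> i\<close> by (intro exI[of _ j]) (auto simp: e'_eq follow_def)
          qed
        qed
        moreover have "i' < m" if "i' \<in> insert i (covered m k s e)" for i'
          using that i by (auto simp: covered_def)
        ultimately show ?thesis
          unfolding covered_def[of m k ?s e'] by blast
      qed
      have bnd: "covered m k ?s e' \<subseteq> {..<m}"
        by (auto simp: covered_def)
      have fin: "finite (covered m k s e)"
        by (simp add: covered_def)
      have "Suc (card (covered m k s e)) = card (insert i (covered m k s e))"
        using new fin by simp
      also have "\<dots> \<le> card (covered m k ?s e')"
        using sub bnd finite_subset by (intro card_mono) auto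
      finally have "card (covered m k s e) < card (covered m k ?s e')" by simp
      moreover have "card (covered m k ?s e') \<le> m"
        using card_mono[OF _ bnd] by simp
      ultimately have "m - card (covered m k ?s e') < m - card (covered m k s e)"
        by linarith
      then have "(potential m k ?s e', potential m k s e) \<in> potential_less"
        unfolding potential_def dist by simp
      moreover have "kept m k ?s e'"
        using kept unfolding kept_def dist .
      moreover have "unit_step (s j) (?s j)" for j
        using follow_step by (auto simp: sgn_if)
      ultimately show ?thesis by blast
    qed
  qed
qed

section \<open>Fibonacci cubes as retracts\<close>

definition hamming :: "bool list \<Rightarrow> bool list \<Rightarrow> nat" where
  "hamming u v = card {i. i < length u \<and> u ! i \<noteq> v ! i}"

lemma hamming_Cons: "hamming (x # u) (y # v) = of_bool (x \<noteq> y) + hamming u v"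
proof -
  let ?D = "{i. i < length u \<and> u ! i \<noteq> v ! i}"
  have "{i. i < length (x # u) \<and> (x # u) ! i \<noteq> (y # v) ! i} = (if x \<noteq> y then {0} else {}) \<union> Suc ` ?D"
  proof (rule set_eqI)
    show "i \<in> {i. i < length (x # u) \<and> (x # u) ! i \<noteq> (y # v) ! i} \<longleftrightarrow>
        i \<in> (if x \<noteq> y then {0} else {}) \<union> Suc ` ?D" for i
      by (cases i) auto
  qed
  moreover have "card (Suc ` ?D) = card ?D"
    by (intro card_image) simp
  ultimately show ?thesis
    unfolding hamming_def by (simp add: card_insert_if image_iff)
qed

lemma hamming_refl [simp]: "hamming u u = 0"
  by (simp add: hamming_def)

lemma hamming_eq_0: "length u = length v \<Longrightarrow> hamming u v = 0 \<longleftrightarrow> u = v"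
  by (auto simp: hamming_def list_eq_iff_nth_eq)

lemma hamming_le_1:
  assumes "\<And>i. i < length u \<Longrightarrow> u ! i \<noteq> v ! i \<Longrightarrow> i = p"
  shows "hamming u v \<le> 1"
proof -
  have "{i. i < length u \<and> u ! i \<noteq> v ! i} \<subseteq> {p}"
    using assms by blast
  then show ?thesis
    unfolding hamming_def using card_mono[of "{p}"] by fastforce
qed

lemma fib_strings_conv_successively:
  "w \<in> fib_strings n \<longleftrightarrow> length w = n \<and> successively (\<lambda>x y. x \<longrightarrow> \<not> y) w"
  by (auto simp: fib_strings_def successively_conv_nth)

text \<open>Staying and crossing an edge become one inequality, so a map into the cube that
  preserves it turns moves into moves.\<close>

lemma move_fib_cube:
  "move (fib_cube n) u v \<longleftrightarrow> u \<in> fib_strings n \<and> v \<in> fib_strings n \<and> hamming u v \<le> 1"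
proof -
  have "hamming u v \<le> 1 \<longleftrightarrow> v = u \<or> hamming u v = 1" if "length u = n" "length v = n"
    using hamming_eq_0[of u v] that by auto
  then show ?thesis
    by (auto simp: move_def fib_cube_def hypercube_def fib_strings_def hamming_def)
qed

section \<open>The retraction onto strings without adjacent ones\<close>

fun cancel_ones :: "bool list \<Rightarrow> bool list" where
  "cancel_ones (x # y # w) =
    (if x \<and> y then False # cancel_ones (False # w) else x # cancel_ones (y # w))"
| "cancel_ones w = w"

lemma length_cancel_ones [simp]: "length (cancel_ones w) = length w"
  by (induction w rule: cancel_ones.induct) auto

lemma cancel_ones_False: "cancel_ones (False # w) = False # cancel_ones w"
  by (cases w) auto

lemma successively_cancel_ones: "successively (\<lambda>x y. x \<longrightarrow> \<not> y) (cancel_ones w)"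
  by (induction w rule: cancel_ones.induct) (auto simp: cancel_ones_False successively_Cons)

lemma cancel_ones_ident: "successively (\<lambda>x y. x \<longrightarrow> \<not> y) w \<Longrightarrow> cancel_ones w = w"
  by (induction w rule: cancel_ones.induct) auto

text \<open>Since a cancelled second bit returns to the argument as \<open>False\<close>, each step
  strips one letter. Either the output heads agree and the remaining arguments differ in at most one
  letter, or the heads differ and those arguments are equal.\<close>

lemma hamming_cancel_ones:
  "length u = length v \<Longrightarrow> hamming u v \<le> 1 \<Longrightarrow> hamming (cancel_ones u) (cancel_ones v) \<le> 1"
proof (induction u arbitrary: v rule: cancel_ones.induct)
  case (1 x y w)
  then obtain x' y' w' where v: "v = x' # y' # w'" and len: "length w = length w'"
    by (auto simp: length_Suc_conv Suc_length_conv)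
  show ?case
    using 1(1)[of "False # w'"] 1(1)[of "y' # w'"] 1(2)[of "False # w'"] 1(2)[of "y' # w'"]
      1(4) hamming_eq_0[OF len] len
    unfolding v by (cases x; cases y; cases x'; cases y') (auto simp: hamming_Cons)
next
  case ("2_2" x)
  then show ?case by (cases v) auto
qed auto

text \<open>The path is \<open>10\<close>, \<open>00\<close>, \<open>01\<close>, numbered 0, 1, 2.
  Bits beyond the end count as zero, so for odd \<open>n\<close> the last block is never 2.\<close>

definition coords :: "nat \<Rightarrow> bool list \<Rightarrow> nat \<Rightarrow> int" where
  "coords n w i = (if 2 * i < n \<and> w ! (2 * i) then 0
    else if Suc (2 * i) < n \<and> w ! Suc (2 * i) then 2 else 1)"

definition bits :: "nat \<Rightarrow> (nat \<Rightarrow> int) \<Rightarrow> bool list" where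
  "bits n c = map (\<lambda>p. c (p div 2) = (if even p then 0 else 2)) [0..<n]"

text \<open>No block decodes to \<open>11\<close>, but adjacent ones can arise across blocks, as in
  \<open>01\<close> followed by \<open>10\<close>; cancelling repairs this.\<close>

definition vertex :: "nat \<Rightarrow> (nat \<Rightarrow> int) \<Rightarrow> bool list" where
  "vertex n c = cancel_ones (bits n c)"

lemma length_bits [simp]: "length (bits n c) = n"
  by (simp add: bits_def)

lemma vertex_in: "vertex n c \<in> fib_strings n"
  by (simp add: vertex_def fib_strings_conv_successively successively_cancel_ones)

lemma bits_coords:
  assumes "w \<in> fib_strings n"
  shows "bits n (coords n w) = w"
proof (rule nth_equalityI)
  show "length (bits n (coords n w)) = length w"
    using assms by (simp add: fib_strings_def)
  fix p assume "p < length (bits n (coords n w))"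
  then have p: "p < n" by simp
  have fib: "\<not> (w ! i \<and> w ! Suc i)" if "Suc i < n" for i
    using assms that by (auto simp: fib_strings_def)
  show "bits n (coords n w) ! p = w ! p"
  proof (cases "even p")
    case True
    then obtain i where "p = 2 * i" by blast
    with p show ?thesis by (simp add: bits_def coords_def)
  next
    case False
    then obtain i where "p = Suc (2 * i)" by (metis oddE Suc_eq_plus1)
    with p fib[of "2 * i"] show ?thesis by (simp add: bits_def coords_def)
  qed
qed

lemma vertex_coords: "w \<in> fib_strings n \<Longrightarrow> vertex n (coords n w) = w"
  by (simp add: vertex_def bits_coords cancel_ones_ident fib_strings_conv_successively)

lemma vertex_eqI:
  assumes "ldist ((n + 1) div 2) c (coords n w) = 0" "w \<in> fib_strings n"
  shows "vertex n c = w"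
proof -
  have "bits n c = bits n (coords n w)"
    using assms(1) by (auto simp: bits_def ldist_eq_0)
  then show ?thesis
    using vertex_coords[OF assms(2)] by (simp add: vertex_def)
qed

lemma unit_step_move:
  assumes "unit_step c c'"
  shows "move (fib_cube n) (vertex n c) (vertex n c')"
proof -
  from assms obtain i z where c': "c' = c(i := z)" "\<bar>z - c i\<bar> \<le> 1"
    by (auto simp: unit_step_def)
  have "hamming (bits n c) (bits n c') \<le> 1"
  proof (rule hamming_le_1)
    fix p assume "p < length (bits n c)" "bits n c ! p \<noteq> bits n c' ! p"
    then have "p div 2 = i" "(c i = (if even p then 0 else 2)) \<noteq> (z = (if even p then 0 else 2))"
      by (auto simp: bits_def c' split: if_splits)
    \<comment> \<open>A unit step cannot involve both 0 and 2, so only one bit of the block changes: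
      the first if 0 is involved, otherwise the second.\<close>
    then show "p = (if c i = 0 \<or> z = 0 then 2 * i else 2 * i + 1)"
      using c'(2) by (cases "even p") auto
  qed
  then show ?thesis
    unfolding move_fib_cube using vertex_in hamming_cancel_ones
    by (auto simp: vertex_def)
qed

lemma move_unit_step:
  assumes "move (fib_cube n) u v"
  shows "unit_step (coords n u) (coords n v)"
proof -
  have fib: "u \<in> fib_strings n" "v \<in> fib_strings n" and ham: "hamming u v \<le> 1"
    using assms by (auto simp: move_fib_cube)
  have len: "length u = n"
    using fib by (simp add: fib_strings_def)
  have "\<exists>p. \<forall>i<n. i \<noteq> p \<longrightarrow> u ! i = v ! i"
  proof (rule ccontr)
    assume "\<not> ?thesis"
    then obtain a b where "a < n" "u ! a \<noteq> v ! a" "b < n" "u ! b \<noteq> v ! b" "a \<noteq> b"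
      by metis
    then have "card {a, b} \<le> hamming u v"
      unfolding hamming_def by (intro card_mono) (auto simp: len)
    with ham \<open>a \<noteq> b\<close> show False by simp
  qed
  then obtain p where p: "\<And>i. i < n \<Longrightarrow> i \<noteq> p \<Longrightarrow> u ! i = v ! i" by blast
  have "coords n v i = coords n u i" if "i \<noteq> p div 2" for i
  proof -
    have "2 * i \<noteq> p" "Suc (2 * i) \<noteq> p" using that by auto
    then show ?thesis using p by (auto simp: coords_def)
  qed
  then have "coords n v = (coords n u)(p div 2 := coords n v (p div 2))"
    by auto
  moreover have "\<bar>coords n v (p div 2) - coords n u (p div 2)\<bar> \<le> 1"
  proof -
    define q where "q = p div 2"
    \<comment> \<open>Without the block \<open>11\<close>, two blocks differing in a single bit are
      \<open>00\<close> and one of its path neighbours.\<close>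
    have fib_q: "\<not> (w ! (2 * q) \<and> w ! Suc (2 * q))" if "w \<in> fib_strings n" "Suc (2 * q) < n" for w
      using that by (auto simp: fib_strings_def)
    have "p = 2 * q \<or> p = Suc (2 * q)"
      unfolding q_def by presburger
    then show ?thesis
      using p[of "2 * q"] p[of "Suc (2 * q)"] fib_q[OF fib(1)] fib_q[OF fib(2)]
      unfolding q_def[symmetric] by (auto simp: coords_def)
  qed
  ultimately show ?thesis
    unfolding unit_step_def by blast
qed

section \<open>Upper bound: the pursuit transferred to the cube\<close>

lemma cops_win_fib_cube:
  assumes k: "(n + 1) div 2 < 2 * k"
  shows "cops_win (fib_cube n) k"
proof -
  let ?m = "(n + 1) div 2"
  let ?R = "inv_image potential_less (\<lambda>(s, x). potential ?m k s (coords n x))"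
  have verts: "pverts (fib_cube n) = fib_strings n"
    by (simp add: fib_cube_def)
  have bounds: "0 \<le> coords n x i \<and> coords n x i \<le> 2" for x i
    by (simp add: coords_def)
  show ?thesis
  proof (rule cops_winI[where pos = "\<lambda>s j. vertex n (s j)" and R = ?R and ?s0.0 = "\<lambda>_ _. 0"
        and I = "\<lambda>s x. kept ?m k s (coords n x)"])
    show "wf ?R"
      by (intro wf_inv_image wf_lex_prod wf_less_than)
    show "vertex n (s j) \<in> pverts (fib_cube n)" for s :: "nat \<Rightarrow> nat \<Rightarrow> int" and j
      by (simp add: verts vertex_in)
  next
    fix x assume "x \<in> pverts (fib_cube n)"
    then have x: "x \<in> fib_strings n" by (simp add: verts)
    let ?e = "coords n x" and ?c = "\<lambda>_. 0 :: int"
    show "\<exists>s. (\<forall>j<k. move (fib_cube n) (vertex n ?c) (vertex n (s j))) \<and>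
        ((\<exists>j<k. vertex n (s j) = x) \<or> kept ?m k s ?e)"
    \<comment> \<open>Within distance 1 the first step captures; otherwise the cops wait, and
      distance 2 meets every \<open>reserve\<close>.\<close>
    proof (cases "ldist ?m ?c ?e \<le> 1")
      case True
      then have "\<exists>c. unit_step ?c c \<and> ldist ?m c ?e = 0"
        using ldist_decrease[of ?m ?c ?e] unit_step_refl[of ?c]
        by (cases "ldist ?m ?c ?e = 0") force+
      then show ?thesis
        using k x vertex_eqI unit_step_move by (metis gr0I mult_0_right not_less0)
    next
      case False
      then show ?thesis
        by (intro exI[of _ "\<lambda>_. ?c"]) (auto simp: kept_def reserve_def intro: unit_step_move)
    qed
  next
    fix s x y assume I: "kept ?m k s (coords n x)" and mv: "move (fib_cube n) x y"
    from pursuit_step[OF I k move_unit_step[OF mv] bounds bounds] obtain s' where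
      s': "\<And>j. j < k \<Longrightarrow> unit_step (s j) (s' j)"
      "(\<exists>j<k. ldist ?m (s' j) (coords n y) = 0) \<or> kept ?m k s' (coords n y) \<and>
        (potential ?m k s' (coords n y), potential ?m k s (coords n x)) \<in> potential_less"
      by blast
    have "y \<in> fib_strings n" using mv by (simp add: move_fib_cube)
    then have "(\<exists>j<k. vertex n (s' j) = y) \<or>
        kept ?m k s' (coords n y) \<and> ((s', y), (s, x)) \<in> ?R"
      using s'(2) vertex_eqI by auto
    then show "\<exists>s'. (\<forall>j<k. move (fib_cube n) (vertex n (s j)) (vertex n (s' j))) \<and>
        ((\<exists>j<k. vertex n (s' j) = y) \<or> kept ?m k s' (coords n y) \<and> ((s', y), (s, x)) \<in> ?R)"
      using s'(1) unit_step_move by blast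
  qed
qed

section \<open>Evasion in a hypercube\<close>

text \<open>Here \<open>D\<close> holds the coordinates in which a cop differs from the robber, and
  \<open>sym_diff D {i}\<close> those after the robber flips \<open>i\<close>.\<close>

lemma card_sym_diff_singleton_le_1:
  assumes "finite D" "D \<noteq> {}" "card (sym_diff D {i}) \<le> 1"
  shows "i \<in> D \<and> card D \<le> 2"
proof (cases "i \<in> D")
  case True
  then have "sym_diff D {i} = D - {i}" by auto
  with assms True show ?thesis by simp
next
  case False
  then have "sym_diff D {i} = insert i D" by auto
  with assms False have "card D = 0" by simp
  with assms show ?thesis by simp
qed

text \<open>Sets are hypercube vertices. If staying is unsafe, some cop is at distance 1 and
  threatens only one flip; every other cop threatens at most two. That excludes at most
  \<open>2 * k - 1\<close> of the \<open>m\<close> flips.\<close>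

lemma exists_safe_move:
  fixes C :: "nat \<Rightarrow> nat set"
  assumes k: "2 * k \<le> m" and A: "A \<subseteq> {..<m}"
    and C: "\<And>j. j < k \<Longrightarrow> C j \<subseteq> {..<m}" "\<And>j. j < k \<Longrightarrow> C j \<noteq> A"
  shows "\<exists>B\<subseteq>{..<m}. card (sym_diff A B) \<le> 1 \<and> (\<forall>j<k. 1 < card (sym_diff (C j) B))"
proof (cases "\<exists>j0<k. card (sym_diff (C j0) A) \<le> 1")
  case False
  then show ?thesis
    using A by (intro exI[of _ A]) auto
next
  case True
  then obtain j0 where j0: "j0 < k" "card (sym_diff (C j0) A) \<le> 1" by blast
  define D where "D j = sym_diff (C j) A" for j
  have D: "finite (D j)" "D j \<noteq> {}" if "j < k" for j
    using C[OF that] A unfolding D_def by (auto intro: finite_subset)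
  \<comment> \<open>Contains every flip that would leave the robber within one step of cop
    \<open>j\<close>.\<close>
  define T where "T j = (if card (D j) \<le> 2 then D j else {})" for j
  have "card (\<Union>j<k. T j) \<le> (\<Sum>j<k. card (T j))"
    by (rule card_UN_le) simp
  also have "\<dots> = card (T j0) + (\<Sum>j\<in>{..<k} - {j0}. card (T j))"
    using j0 by (simp add: sum.remove)
  also have "\<dots> \<le> 1 + (\<Sum>j\<in>{..<k} - {j0}. 2)"
    using j0(2) by (intro add_mono sum_mono) (auto simp: T_def D_def)
  also have "\<dots> < m"
    using j0(1) k by simp
  finally have "card (\<Union>j<k. T j) < card {..<m}" by simp
  moreover have "finite (\<Union>j<k. T j)"
    using D by (auto simp: T_def)
  ultimately have "\<not> {..<m} \<subseteq> (\<Union>j<k. T j)"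
    using card_mono leD by blast
  then obtain i where i: "i < m" "\<And>j. j < k \<Longrightarrow> i \<notin> T j" by blast
  let ?B = "sym_diff A {i}"
  have "1 < card (sym_diff (C j) ?B)" if "j < k" for j
  proof (rule ccontr)
    assume "\<not> ?thesis"
    moreover have "sym_diff (C j) ?B = sym_diff (D j) {i}"
      by (auto simp: D_def)
    ultimately have "card (sym_diff (D j) {i}) \<le> 1"
      by (simp only: not_less)
    from card_sym_diff_singleton_le_1[OF D[OF that] this] have "i \<in> T j"
      by (simp add: T_def)
    with i(2) that show False by blast
  qed
  moreover have "sym_diff A ?B = {i}" by auto
  ultimately show ?thesis
    using A i(1) by (intro exI[of _ ?B]) auto
qed

definition shadow :: "nat \<Rightarrow> bool list \<Rightarrow> nat set" where
  "shadow n w = {i. i < (n + 1) div 2 \<and> w ! (2 * i)}"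

text \<open>A section of \<open>shadow\<close>: ones at even positions are never adjacent, so every
  subset is realised by a vertex.\<close>

definition sparse :: "nat \<Rightarrow> nat set \<Rightarrow> bool list" where
  "sparse n A = map (\<lambda>p. even p \<and> p div 2 \<in> A) [0..<n]"

lemma shadow_sub: "shadow n w \<subseteq> {..<(n + 1) div 2}"
  by (auto simp: shadow_def)

lemma shadow_sparse: "A \<subseteq> {..<(n + 1) div 2} \<Longrightarrow> shadow n (sparse n A) = A"
proof -
  assume A: "A \<subseteq> {..<(n + 1) div 2}"
  have "2 * i < n" if "i < (n + 1) div 2" for i
    using that by linarith
  with A show ?thesis
    by (fastforce simp: shadow_def sparse_def)
qed

lemma sparse_in: "sparse n A \<in> fib_strings n"
  by (auto simp: sparse_def fib_strings_def)

lemma move_sparse: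
  assumes "A \<subseteq> {..<(n + 1) div 2}" "B \<subseteq> {..<(n + 1) div 2}" "card (sym_diff A B) \<le> 1"
  shows "move (fib_cube n) (sparse n A) (sparse n B)"
proof -
  have fin: "finite (sym_diff A B)"
    using assms by (auto intro: finite_subset)
  have "hamming (sparse n A) (sparse n B) \<le> card ((*) 2 ` sym_diff A B)"
    unfolding hamming_def
    using fin by (intro card_mono) (auto simp: sparse_def elim!: evenE)
  also have "\<dots> \<le> 1"
    using assms(3) fin card_image_le le_trans by blast
  finally show ?thesis
    by (simp add: move_fib_cube sparse_in)
qed

text \<open>Doubling injects the coordinates where the shadows differ into the positions where the
  strings differ.\<close>

lemma card_shadow_move:
  assumes "move (fib_cube n) u v"
  shows "card (sym_diff (shadow n u) (shadow n v)) \<le> 1"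
proof -
  have len: "length u = n"
    using assms by (simp add: move_fib_cube fib_strings_def)
  have "card (sym_diff (shadow n u) (shadow n v)) = card ((*) 2 ` sym_diff (shadow n u) (shadow n v))"
    by (intro card_image[symmetric]) (simp add: inj_on_def)
  also have "\<dots> \<le> hamming u v"
    unfolding hamming_def by (intro card_mono) (auto simp: shadow_def len)
  finally show ?thesis
    using assms by (simp add: move_fib_cube)
qed

lemma not_cops_win_fib_cube:
  assumes k: "2 * k \<le> (n + 1) div 2"
  shows "\<not> cops_win (fib_cube n) k"
proof
  let ?m = "(n + 1) div 2"
  assume "cops_win (fib_cube n) k"
  then obtain \<sigma> where legal: "legal_strategy (fib_cube n) k \<sigma>"
    and win: "\<And>r. robber_play (fib_cube n) r \<Longrightarrow> captures k \<sigma> r"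
    unfolding cops_win_def by blast
  let ?C = "\<lambda>h j. shadow n (\<sigma> h j)"
  \<comment> \<open>The history \<open>h\<close> stops before \<open>B\<close> is entered; shadows
    at distance 2 or more cannot reach \<open>B\<close> in the cops' next move.\<close>
  define safe where "safe h B \<longleftrightarrow> B \<subseteq> {..<?m} \<and> (\<forall>j<k. 1 < card (sym_diff (?C h j) B))" for h B
  have safe_move: "\<exists>B. safe h B \<and> card (sym_diff A B) \<le> 1"
    if "A \<subseteq> {..<?m}" "\<And>j. j < k \<Longrightarrow> ?C h j \<noteq> A" for A h
    using exists_safe_move[OF k that(1), of "?C h"] that(2) shadow_sub unfolding safe_def by blast
  \<comment> \<open>There are \<open>2 ^ ?m\<close> shadows and fewer cops. The robber's start
    \<open>B0\<close> is a safe move from an unoccupied \<open>A\<close>.\<close>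
  obtain A where A: "A \<subseteq> {..<?m}" "\<And>j. j < k \<Longrightarrow> ?C [] j \<noteq> A"
  proof (rule ccontr)
    assume no: "\<not> thesis"
    have "Pow {..<?m} \<subseteq> ?C [] ` {..<k}"
    proof
      fix A assume "A \<in> Pow {..<?m}"
      with no that[of A] show "A \<in> ?C [] ` {..<k}" by auto
    qed
    from surj_card_le[OF _ this] have "2 ^ ?m \<le> k" by (simp add: card_Pow)
    moreover have "?m < 2 ^ ?m" by (rule less_exp)
    ultimately show False using k by linarith
  qed
  have "\<exists>B. safe [] B \<and> card (sym_diff A B) \<le> 1"
    by (rule safe_move[OF A])
  then obtain B0 where B0: "safe [] B0" by (elim exE conjE)
  \<comment> \<open>The fallback of staying makes \<open>nxt\<close> legal even on an occupied
    vertex. So \<open>r\<close> is a play before it is known to be safe, and \<open>legal\<close>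
    only constrains \<sigma> along plays.\<close>
  define good where "good h A B \<longleftrightarrow> B \<subseteq> {..<?m} \<and> card (sym_diff A B) \<le> 1 \<and>
    ((\<forall>j<k. ?C h j \<noteq> A) \<longrightarrow> safe h B)" for h A B
  define nxt where "nxt h A = (SOME B. good h A B)" for h A
  have good: "good h A (nxt h A)" if A: "A \<subseteq> {..<?m}" for h A
  proof -
    have "\<exists>B. good h A B"
    proof (cases "\<forall>j<k. ?C h j \<noteq> A")
      case True
      then have "\<exists>B. safe h B \<and> card (sym_diff A B) \<le> 1"
        by (intro safe_move[OF A]) simp
      with True show ?thesis by (auto simp: good_def safe_def)
    next
      case False
      then show ?thesis using A by (intro exI[of _ A]) (auto simp: good_def)
    qed
    then show ?thesis unfolding nxt_def by (rule someI_ex)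
  qed
  have nxt: "\<And>h A. A \<subseteq> {..<?m} \<Longrightarrow> nxt h A \<subseteq> {..<?m}"
    "\<And>h A. A \<subseteq> {..<?m} \<Longrightarrow> card (sym_diff A (nxt h A)) \<le> 1"
    "\<And>h A. A \<subseteq> {..<?m} \<Longrightarrow> (\<And>j. j < k \<Longrightarrow> ?C h j \<noteq> A) \<Longrightarrow> safe h (nxt h A)"
    using good unfolding good_def by simp_all
  \<comment> \<open>The history is carried along because \<sigma> depends on it; it includes the
    current vertex, since the cops answer before the robber moves on.\<close>
  define st where "st = rec_nat ([], B0)
    (\<lambda>_ (h, A). (h @ [sparse n A], nxt (h @ [sparse n A]) A))"
  define pos where "pos t = snd (st t)" for t
  define r where "r t = sparse n (pos t)" for t
  have st_0: "st 0 = ([], B0)" by (simp add: st_def)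
  have st_Suc: "st (Suc t) = (fst (st t) @ [r t], nxt (fst (st t) @ [r t]) (pos t))" for t
    by (simp add: st_def r_def pos_def split_beta)
  have hist: "fst (st t) = map r [0..<t]" for t
    by (induction t) (auto simp: st_0 st_Suc)
  have pos_0: "pos 0 = B0" by (simp add: pos_def st_0)
  have pos_Suc: "pos (Suc t) = nxt (map r [0..<Suc t]) (pos t)" for t
    unfolding pos_def[of "Suc t"] st_Suc hist by simp
  have pos_sub: "pos t \<subseteq> {..<?m}" for t
    by (induction t) (use B0 nxt(1) in \<open>auto simp: pos_0 pos_Suc safe_def simp del: upt_Suc\<close>)
  have play: "robber_play (fib_cube n) r"
    unfolding robber_play_def
  proof
    fix t
    show "move (fib_cube n) (r t) (r (Suc t))"
      unfolding r_def
    proof (rule move_sparse[OF pos_sub pos_sub])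
      show "card (sym_diff (pos t) (pos (Suc t))) \<le> 1"
        unfolding pos_Suc by (rule nxt(2)[OF pos_sub])
    qed
  qed
  have dodge: "?C (map r [0..<Suc t]) j \<noteq> pos t" if "safe (map r [0..<t]) (pos t)" "j < k" for t j
  proof
    assume eq: "?C (map r [0..<Suc t]) j = pos t"
    have "move (fib_cube n) (\<sigma> (map r [0..<t]) j) (\<sigma> (map r [0..<Suc t]) j)"
      using legal play \<open>j < k\<close> unfolding legal_strategy_def cops_at_def by blast
    from card_shadow_move[OF this]
    have "card (sym_diff (?C (map r [0..<t]) j) (pos t)) \<le> 1"
      unfolding eq .
    with that show False
      unfolding safe_def by (metis not_le)
  qed
  have safe: "safe (map r [0..<t]) (pos t)" for t
  proof (induction t)
    case 0
    then show ?case by (simp add: pos_0 B0)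
  next
    case (Suc t)
    show ?case
      unfolding pos_Suc by (rule nxt(3)[OF pos_sub dodge[OF Suc]])
  qed
  have "cops_at \<sigma> r t j \<noteq> r t \<and> cops_at \<sigma> r (Suc t) j \<noteq> r t" if "j < k" for t j
  proof -
    have "1 < card (sym_diff (?C (map r [0..<t]) j) (pos t))"
      using safe[of t] that by (simp add: safe_def)
    then have "?C (map r [0..<t]) j \<noteq> pos t" by auto
    moreover have "shadow n (r t) = pos t"
      unfolding r_def by (rule shadow_sparse[OF pos_sub])
    moreover have "?C (map r [0..<Suc t]) j \<noteq> pos t"
      by (rule dodge[OF safe that])
    ultimately show ?thesis
      unfolding cops_at_def by metis
  qed
  then show False
    using win[OF play] unfolding captures_def by blast
qed

text \<open>With \<open>m = (n + 1) div 2\<close>, the value \<open>m div 2 + 1\<close> is the least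
  \<open>k\<close> with \<open>m < 2 * k\<close>, where the two bounds meet.\<close>

lemma cop_number_fib_cube: "cop_number (fib_cube n) = (n + 1) div 2 div 2 + 1"
  unfolding cop_number_def
proof (rule Least_equality)
  show "cops_win (fib_cube n) ((n + 1) div 2 div 2 + 1)"
    by (rule cops_win_fib_cube) presburger
  show "(n + 1) div 2 div 2 + 1 \<le> k" if "cops_win (fib_cube n) k" for k
  proof (rule ccontr)
    assume "\<not> ?thesis"
    then have "2 * k \<le> (n + 1) div 2" by presburger
    with not_cops_win_fib_cube that show False by blast
  qed
qed

theorem theorem4p2:
  shows "(\<forall>n::nat. int (cop_number (fib_cube n)) = \<lceil>(real_of_int \<lceil>real n / 2\<rceil> + 1) / 2\<rceil>) \<and>
    (\<forall>q::nat. cop_number (fib_cube (4 * q)) = q + 1 \<and>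
      cop_number (fib_cube (4 * q + 1)) = q + 1 \<and>
      cop_number (fib_cube (4 * q + 2)) = q + 1 \<and>
      cop_number (fib_cube (4 * q + 3)) = q + 2)"
proof (intro conjI allI)
  fix n :: nat
  have inner: "\<lceil>real n / 2\<rceil> = int ((n + 1) div 2)"
    by (rule ceiling_unique) (cases "even n"; auto elim!: evenE oddE)+
  show "int (cop_number (fib_cube n)) = \<lceil>(real_of_int \<lceil>real n / 2\<rceil> + 1) / 2\<rceil>"
    unfolding inner cop_number_fib_cube
    by (rule ceiling_unique[symmetric]; cases "even ((n + 1) div 2)") (auto elim!: evenE oddE)
qed (unfold cop_number_fib_cube, presburger+)

end
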